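(* For every integer $n\ge1$, $P_n=\Sigma_n$; that is, a matrix in $\mathcal{S}(2)\otimes\mathcal{Q}(n)$ is $S_+(2)\otimes Q_+(n)$-separable if and only if it is positive semidefinite.
   Context: $\mathcal{S}(2)$ is the real vector space of real symmetric $2\times 2$ matrices and $S_+(2)$ its cone of positive semidefinite (PSD) matrices. $\mathcal{Q}(N)$ is the real vector space of quaternionic hermitian $N\times N$ matrices ($A=A^*$, with $*$ the quaternionic conjugate transpose) and $Q_+(N)$ its cone of PSD matrices ($v^*Av\ge0$ for all $v\in\mathbb{H}^N$). The (real) tensor product $\mathcal{S}(2)\otimes\mathcal{Q}(n)$ is regarded as a subspace of $\mathcal{Q}(2n)$ via the Kronecker product; it consists of the matrices $\begin{pmatrix}B_{11}&B_{12}\\ B_{12}&B_{22}\end{pmatrix}$ with $B_{11},B_{12},B_{22}\in\mathcal{Q}(n)$. $P_n$ is the intersection of $\mathcal{S}(2)\otimes\mathcal{Q}(n)$ with $Q_+(2n)$. $\Sigma_n$ is the cone of $S_+(2)\otimes Q_+(n)$-separable matrices, i.e. finite sums $\sum_l A_l\otimes B_l$ with $A_l\in S_+(2)$, $B_l\in Q_+(n)$. *)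

theory Defs
  imports "HOL-Analysis.Analysis"
begin

subsection \<open>Quaternions\<close>

text \<open>\<^term>\<open>Quat a b c d\<close> stands for a + b i + c j + d k, with i j = k.\<close>

datatype quat = Quat (qRe: real) (qI: real) (qJ: real) (qK: real)

lemma quat_eq_iff: "x = y \<longleftrightarrow> qRe x = qRe y \<and> qI x = qI y \<and> qJ x = qJ y \<and> qK x = qK y"
  by (cases x; cases y) simp

instantiation quat :: ring_1
begin

definition "0 = Quat 0 0 0 0"
definition "1 = Quat 1 0 0 0"
definition "x + y = Quat (qRe x + qRe y) (qI x + qI y) (qJ x + qJ y) (qK x + qK y)"
definition "x - y = Quat (qRe x - qRe y) (qI x - qI y) (qJ x - qJ y) (qK x - qK y)"
definition "- x = Quat (- qRe x) (- qI x) (- qJ x) (- qK x)"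
definition "x * y = Quat
  (qRe x * qRe y - qI x * qI y - qJ x * qJ y - qK x * qK y)
  (qRe x * qI y + qI x * qRe y + qJ x * qK y - qK x * qJ y)
  (qRe x * qJ y - qI x * qK y + qJ x * qRe y + qK x * qI y)
  (qRe x * qK y + qI x * qJ y - qJ x * qI y + qK x * qRe y)"

instance
  by standard
    (simp_all add: quat_eq_iff zero_quat_def one_quat_def plus_quat_def minus_quat_def
      uminus_quat_def times_quat_def algebra_simps)

end

instantiation quat :: real_algebra_1
begin

definition "r *\<^sub>R x = Quat (r * qRe x) (r * qI x) (r * qJ x) (r * qK x)"

instance
  by standard
    (simp_all add: quat_eq_iff scaleR_quat_def plus_quat_def times_quat_def algebra_simps)

end

lemma quat_units:
  defines "i \<equiv> Quat 0 1 0 0" and "j \<equiv> Quat 0 0 1 0" and "k \<equiv> Quat 0 0 0 1"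
  shows "i * i = -1" "j * j = -1" "k * k = -1" "i * j * k = -1"
  by (simp_all add: assms quat_eq_iff times_quat_def uminus_quat_def one_quat_def)

definition qcnj :: "quat \<Rightarrow> quat"
  where "qcnj x = Quat (qRe x) (- qI x) (- qJ x) (- qK x)"


subsection \<open>Symmetric and quaternionic hermitian matrices\<close>

definition sym_mats :: "(real^'m^'m) set"
  where "sym_mats = {A. transpose A = A}"

definition psd_sym_mats :: "(real^'m^'m) set"
  where "psd_sym_mats = {A \<in> sym_mats. \<forall>x. 0 \<le> x \<bullet> (A *v x)}"

definition qadjoint :: "quat^'n^'m \<Rightarrow> quat^'m^'n"
  where "qadjoint A = (\<chi> i j. qcnj (A $ j $ i))"

definition herm_mats :: "(quat^'m^'m) set"
  where "herm_mats = {A. qadjoint A = A}"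

text \<open>The quaternion \<open>v\<^sup>* A v\<close>.\<close>

definition qform :: "quat^'m^'m \<Rightarrow> quat^'m \<Rightarrow> quat"
  where "qform A v = (\<Sum>i\<in>UNIV. qcnj (v $ i) * (A *v v) $ i)"

text \<open>A quaternion is nonnegative if it is a nonnegative real number.\<close>

definition psd_herm_mats :: "(quat^'m^'m) set"
  where "psd_herm_mats = {A \<in> herm_mats. \<forall>v. qform A v \<in> \<real>\<^sub>\<ge>\<^sub>0}"


subsection \<open>Tensor products and separability\<close>

text \<open>The rows and columns of a Kronecker product are indexed by pairs, the first component
  being the index of the block. So the type \<open>2 \<times> 'n\<close> indexes matrices of size 2n, where n
  is the cardinality of \<open>'n\<close>.\<close>

definition kron :: "real^'m^'m \<Rightarrow> quat^'n^'n \<Rightarrow> quat^('m \<times> 'n)^('m \<times> 'n)"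
  where "kron A B = (\<chi> p q. (A $ fst p $ fst q) *\<^sub>R (B $ snd p $ snd q))"

definition tensor_space ::
    "(real^'m^'m) set \<Rightarrow> (quat^'n^'n) set \<Rightarrow> (quat^('m \<times> 'n)^('m \<times> 'n)) set"
  where "tensor_space V W = span {kron A B | A B. A \<in> V \<and> B \<in> W}"

definition separable ::
    "(real^'m^'m) set \<Rightarrow> (quat^'n^'n) set \<Rightarrow> (quat^('m \<times> 'n)^('m \<times> 'n)) set"
  where "separable K L = {M. \<exists>(k::nat) A B.
    (\<forall>l<k. A l \<in> K \<and> B l \<in> L) \<and> M = (\<Sum>l<k. kron (A l) (B l))}"

definition P_cone :: "(quat^(2 \<times> 'n::finite)^(2 \<times> 'n)) set"
  where "P_cone = tensor_space sym_mats herm_mats \<inter> psd_herm_mats"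

definition Sigma_cone :: "(quat^(2 \<times> 'n::finite)^(2 \<times> 'n)) set"
  where "Sigma_cone = separable psd_sym_mats psd_herm_mats"

definition block :: "quat^(2 \<times> 'n::finite)^(2 \<times> 'n) \<Rightarrow> 2 \<Rightarrow> 2 \<Rightarrow> quat^'n^'n"
  where "block M a b = (\<chi> i j. M $ (a, i) $ (b, j))"

lemma qadjoint_add: "qadjoint (A + B) = qadjoint A + qadjoint B"
  by (simp add: qadjoint_def vec_eq_iff qcnj_def plus_quat_def)

lemma qadjoint_scaleR: "qadjoint (r *\<^sub>R A) = r *\<^sub>R qadjoint A"
  by (simp add: qadjoint_def vec_eq_iff qcnj_def scaleR_quat_def)

lemma qadjoint_0: "qadjoint 0 = 0"
  by (simp add: qadjoint_def vec_eq_iff qcnj_def zero_quat_def)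

lemma mem_tensor_space_iff_blocks:
  fixes M :: "quat^(2 \<times> 'n::finite)^(2 \<times> 'n)"
  shows "M \<in> tensor_space sym_mats herm_mats \<longleftrightarrow>
    block M 1 1 \<in> herm_mats \<and> block M 1 2 \<in> herm_mats \<and> block M 2 2 \<in> herm_mats
      \<and> block M 2 1 = block M 1 2" (is "_ \<longleftrightarrow> ?R M")
proof
  have sub: "subspace {M. ?R M}"
  proof (rule subspaceI)
    have b: "block 0 a b = 0" "block (X + Y) a b = block X a b + block Y a b"
      "block (c *\<^sub>R X) a b = c *\<^sub>R block X a b" for a b c and X Y :: "quat^(2 \<times> 'n)^(2 \<times> 'n)"
      by (simp_all add: block_def vec_eq_iff)
    show "0 \<in> {M. ?R M}"
      by (simp add: b herm_mats_def qadjoint_0)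
    show "X + Y \<in> {M. ?R M}" if "X \<in> {M. ?R M}" "Y \<in> {M. ?R M}" for X Y
      using that by (simp add: b herm_mats_def qadjoint_add)
    show "c *\<^sub>R X \<in> {M. ?R M}" if "X \<in> {M. ?R M}" for c X
      using that by (simp add: b herm_mats_def qadjoint_scaleR)
  qed
  have bk: "block (kron A B) a b = (A $ a $ b) *\<^sub>R B" for A and B :: "quat^'n^'n" and a b
    by (simp add: block_def kron_def vec_eq_iff)
  have "{kron A B | A B. A \<in> sym_mats \<and> B \<in> herm_mats} \<subseteq> {M. ?R M}"
  proof clarify
    fix A :: "real^2^2" and B :: "quat^'n^'n"
    assume "A \<in> sym_mats" and B: "B \<in> herm_mats"
    then have "A $ 2 $ 1 = A $ 1 $ 2"
      by (auto simp: sym_mats_def transpose_def dest!: arg_cong[where f = "\<lambda>X. X $ 1 $ 2"])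
    then show "?R (kron A B)"
      using B by (simp add: bk herm_mats_def qadjoint_scaleR)
  qed
  then have "span {kron A B | A B. A \<in> sym_mats \<and> B \<in> herm_mats} \<subseteq> {M. ?R M}"
    using sub by (rule span_minimal)
  then show "M \<in> tensor_space sym_mats herm_mats \<Longrightarrow> ?R M"
    by (auto simp: tensor_space_def)
next
  assume R: "?R M"
  define E :: "real \<Rightarrow> real \<Rightarrow> real \<Rightarrow> real^2^2"
    where "E x y z = vector [vector [x, y], vector [y, z]]" for x y z
  have E: "E x y z $ 1 $ 1 = x" "E x y z $ 1 $ 2 = y" "E x y z $ 2 $ 1 = y" "E x y z $ 2 $ 2 = z"
    for x y z
    by (simp_all add: E_def)
  have sym: "E x y z \<in> sym_mats" for x y z
    by (simp add: sym_mats_def vec_eq_iff transpose_def forall_2 E)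
  have "M $ (a, i) $ (b, j) = (kron (E 1 0 0) (block M 1 1) + kron (E 0 1 0) (block M 1 2)
      + kron (E 0 0 1) (block M 2 2)) $ (a, i) $ (b, j)" for a b i j
  proof -
    have "block M 2 1 $ i $ j = block M 1 2 $ i $ j"
      using R by simp
    then show ?thesis
      using exhaust_2[of a] exhaust_2[of b] by (auto simp: kron_def E block_def)
  qed
  then have M: "M = kron (E 1 0 0) (block M 1 1) + kron (E 0 1 0) (block M 1 2)
      + kron (E 0 0 1) (block M 2 2)"
    unfolding vec_eq_iff split_paired_All by blast
  have K: "kron (E x y z) B \<in> tensor_space sym_mats herm_mats"
    if "B \<in> herm_mats" for x y z and B :: "quat^'n^'n"
  proof -
    have "kron (E x y z) B \<in> {kron A B | A B. A \<in> sym_mats \<and> B \<in> herm_mats}"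
      using sym[of x y z] that by blast
    then show ?thesis
      unfolding tensor_space_def by (rule span_base)
  qed
  have add: "X + Y \<in> tensor_space sym_mats herm_mats"
    if "X \<in> tensor_space sym_mats herm_mats" "Y \<in> tensor_space sym_mats herm_mats"
    for X Y :: "quat^(2 \<times> 'n)^(2 \<times> 'n)"
    using that unfolding tensor_space_def by (rule span_add)
  have "kron (E 1 0 0) (block M 1 1) + kron (E 0 1 0) (block M 1 2)
      + kron (E 0 0 1) (block M 2 2) \<in> tensor_space sym_mats herm_mats"
    by (intro add K) (rule R[THEN conjunct1] R[THEN conjunct2, THEN conjunct1]
      R[THEN conjunct2, THEN conjunct2, THEN conjunct1])+
  with M show "M \<in> tensor_space sym_mats herm_mats"
    by (rule ssubst)
qed

end

theory Submission
  imports Defs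
begin

section \<open>Quaternions as a Euclidean space\<close>

text \<open>A member of \<open>P_cone\<close> has diagonal blocks \<open>A\<close>, \<open>C\<close>
  and both off-diagonal blocks equal to one hermitian \<open>B\<close>; positivity means that the
  real form F(x, y) = x^* A x + 2 Re(x^* B y) + y^* C y is nonnegative (\<open>P_cone_iff\<close>).
  For a Kronecker product of PSD factors this follows by completing the square
  (\<open>kron_mem_P_cone\<close>).

  Conversely, rank-one terms are split off until \<open>A\<close> vanishes
  (\<open>block_mat_mem_Sigma_cone\<close>). Positivity of F forces ker A into ker B, so if A is
  nonzero, the pencil (A, B) has a real generalized eigenvalue: B v = \<mu> A v with v^* A v = 1
  (\<open>generalized_eigenvector\<close>). Put w = A v. Subtracting the separable term (1,
  \<mu>)(1, \<mu>)^T tensor w w^* changes F(x, y) into F(x - v q, y) with q = w^* x + \<mu> w^* y,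
  so F stays nonnegative, while v joins the kernel of A. Once A = 0, also B = 0, and only a
  separable block \<open>C\<close> is left.

  The Euclidean structure on quaternions gives access to real dimension, orthogonal complements and
  compactness of spheres. All positivity arguments then use real inner products, linked to the
  quaternionic pairing by \<open>qRe_qdot\<close>.\<close>

instantiation quat :: euclidean_space
begin

definition "inner x y = qRe x * qRe y + qI x * qI y + qJ x * qJ y + qK x * qK y" for x y :: quat
definition "norm x = sqrt (inner x x)" for x :: quat
definition "sgn x = x /\<^sub>R norm x" for x :: quat
definition "dist x y = norm (x - y)" for x y :: quat
definition
  "(uniformity :: (quat \<times> quat) filter) = (INF e\<in>{0 <..}. principal {(x, y). dist x y < e})"
definition
  "open (U :: quat set) \<longleftrightarrow> (\<forall>x\<in>U. eventually (\<lambda>(x', y). x' = x \<longrightarrow> y \<in> U) uniformity)"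
definition "Basis = {Quat 1 0 0 0, Quat 0 1 0 0, Quat 0 0 1 0, Quat 0 0 0 1}"

instance
proof
  fix x y z :: quat and r :: real and U :: "quat set"
  show "inner x y = inner y x"
    by (simp add: inner_quat_def mult.commute)
  show "inner (x + y) z = inner x z + inner y z"
    by (simp add: inner_quat_def plus_quat_def algebra_simps)
  show "inner (r *\<^sub>R x) y = r * inner x y"
    by (simp add: inner_quat_def scaleR_quat_def algebra_simps)
  show "0 \<le> inner x x"
    by (simp add: inner_quat_def)
  show "inner x x = 0 \<longleftrightarrow> x = 0"
    by (simp add: inner_quat_def quat_eq_iff zero_quat_def add_nonneg_eq_0_iff)
  show "(Basis :: quat set) \<noteq> {}" "finite (Basis :: quat set)"
    by (simp_all add: Basis_quat_def)
  show "inner u v = (if u = v then 1 else 0)" if "u \<in> Basis" "v \<in> Basis" for u v :: quat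
    using that unfolding Basis_quat_def by (elim insertE emptyE) (simp_all add: inner_quat_def)
  show "(\<forall>u\<in>Basis. inner x u = 0) \<longleftrightarrow> x = 0"
    by (cases x) (simp add: Basis_quat_def inner_quat_def zero_quat_def)
  show "dist x y = norm (x - y)"
    by (rule dist_quat_def)
  show "norm x = sqrt (inner x x)"
    by (rule norm_quat_def)
  show "sgn x = x /\<^sub>R norm x"
    by (rule sgn_quat_def)
  show "(uniformity :: (quat \<times> quat) filter) = (INF e\<in>{0 <..}. principal {(x, y). dist x y < e})"
    by (rule uniformity_quat_def)
  show "open U \<longleftrightarrow> (\<forall>x\<in>U. eventually (\<lambda>(x', y). x' = x \<longrightarrow> y \<in> U) uniformity)"
    by (rule open_quat_def)
qed

end

section \<open>Conjugation and real parts of quaternions\<close>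

lemma qcnj_mult: "qcnj (x * y) = qcnj y * qcnj x"
  by (simp add: quat_eq_iff qcnj_def times_quat_def algebra_simps)

lemma qcnj_qcnj [simp]: "qcnj (qcnj x) = x"
  by (simp add: quat_eq_iff qcnj_def)

lemma qcnj_sum: "qcnj (sum f S) = (\<Sum>i\<in>S. qcnj (f i))"
  by (induction S rule: infinite_finite_induct) (simp_all add: qcnj_def plus_quat_def zero_quat_def quat_eq_iff)

lemma qRe_sum: "qRe (sum f S) = (\<Sum>i\<in>S. qRe (f i))"
  by (induction S rule: infinite_finite_induct) (simp_all add: plus_quat_def zero_quat_def)

lemma qRe_qcnj_mult: "qRe (qcnj x * y) = inner x y"
  by (simp add: inner_quat_def qcnj_def times_quat_def)

lemma quat_of_real_eq: "of_real r = Quat r 0 0 0"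
  by (simp add: of_real_def scaleR_quat_def one_quat_def)

lemma qcnj_fixed_imp_real: "qcnj x = x \<Longrightarrow> x = of_real (qRe x)"
  by (simp add: quat_eq_iff qcnj_def quat_of_real_eq)

section \<open>Quaternionic vectors and hermitian matrices\<close>

definition qdot :: "quat^'n \<Rightarrow> quat^'n \<Rightarrow> quat"
  where "qdot u x = (\<Sum>i\<in>UNIV. qcnj (u $ i) * x $ i)"

text \<open>Scalars act on the right because matrices act on the left: by associativity the two
  actions commute, which makes \<open>quat^'n\<close> a right module.\<close>

definition rscale :: "quat^'n \<Rightarrow> quat \<Rightarrow> quat^'n"
  where "rscale x q = (\<chi> i. x $ i * q)"

definition qouter :: "quat^'n \<Rightarrow> quat^'n^'n"
  where "qouter w = (\<chi> i j. w $ i * qcnj (w $ j))"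

lemma qdot_scaleR_left: "qdot (r *\<^sub>R u) x = r *\<^sub>R qdot u x"
proof -
  have "qcnj (r *\<^sub>R q) = r *\<^sub>R qcnj q" for q
    by (simp add: quat_eq_iff qcnj_def scaleR_quat_def)
  then show ?thesis
    by (simp add: qdot_def scaleR_sum_right)
qed

lemma qdot_rscale_right: "qdot u (rscale x q) = qdot u x * q"
  by (simp add: qdot_def rscale_def sum_distrib_right mult.assoc)

lemma qcnj_qdot: "qcnj (qdot u x) = qdot x u"
  by (simp add: qdot_def qcnj_sum qcnj_mult)

lemma qRe_qdot: "qRe (qdot u x) = inner u x"
  by (simp add: qdot_def inner_vec_def qRe_sum qRe_qcnj_mult)

lemma inner_rscale_left: "inner (rscale v q) y = inner q (qdot v y)"
proof -
  have "inner (rscale v q) y = qRe (qcnj q * qdot v y)"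
    by (metis qRe_qdot qcnj_mult qcnj_qdot qdot_rscale_right)
  then show ?thesis
    by (simp add: qRe_qcnj_mult)
qed

lemma qmatrix_scaleR_right: "A *v (r *\<^sub>R x) = r *\<^sub>R (A *v x)" for A :: "quat^'n^'m"
  by (simp add: matrix_vector_mult_def vec_eq_iff scaleR_sum_right)

lemma qmatrix_scaleR_left: "(r *\<^sub>R A) *v x = r *\<^sub>R (A *v x)" for A :: "quat^'n^'m"
  by (simp add: matrix_vector_mult_def vec_eq_iff scaleR_sum_right)

lemma linear_qmatrix: "linear ((*v) A)" for A :: "quat^'n^'m"
  by (rule linearI) (simp_all add: matrix_vector_right_distrib qmatrix_scaleR_right)

lemma qouter_mult: "qouter w *v x = rscale w (qdot w x)"
  by (simp add: matrix_vector_mult_def rscale_def vec_eq_iff qouter_def qdot_def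
      sum_distrib_left mult.assoc)

lemma inner_qouter: "inner x (qouter w *v y) = inner (qdot w x) (qdot w y)"
  by (metis inner_commute inner_rscale_left qouter_mult)

lemma qdot_qadjoint: "qdot x (A *v y) = qdot (qadjoint A *v x) y"
proof -
  have "qdot x (A *v y) = (\<Sum>i\<in>UNIV. \<Sum>j\<in>UNIV. qcnj (x $ i) * A $ i $ j * y $ j)"
    by (simp add: qdot_def matrix_vector_mult_def sum_distrib_left mult.assoc)
  also have "\<dots> = (\<Sum>j\<in>UNIV. \<Sum>i\<in>UNIV. qcnj (x $ i) * A $ i $ j * y $ j)"
    by (rule sum.swap)
  also have "\<dots> = qdot (qadjoint A *v x) y"
    by (simp add: qdot_def matrix_vector_mult_def qadjoint_def sum_distrib_right
        qcnj_sum qcnj_mult)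
  finally show ?thesis .
qed

lemma qdot_herm: "A \<in> herm_mats \<Longrightarrow> qdot x (A *v y) = qdot (A *v x) y"
  by (simp add: qdot_qadjoint herm_mats_def)

lemma inner_herm: "A \<in> herm_mats \<Longrightarrow> inner x (A *v y) = inner (A *v x) y"
  by (metis qRe_qdot qdot_herm)

lemma qform_real:
  assumes "A \<in> herm_mats"
  shows "qdot v (A *v v) = of_real (inner v (A *v v))"
proof -
  have "qcnj (qdot v (A *v v)) = qdot v (A *v v)"
    by (simp add: qcnj_qdot qdot_herm[OF assms])
  then show ?thesis
    by (metis qcnj_fixed_imp_real qRe_qdot)
qed

text \<open>For hermitian \<open>A\<close> the quaternion v^* A v equals its own conjugate, hence is
  real and coincides with the Euclidean inner product.\<close>

lemma psd_herm_iff: "A \<in> psd_herm_mats \<longleftrightarrow> A \<in> herm_mats \<and> (\<forall>v. 0 \<le> inner v (A *v v))"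
proof -
  have "of_real r \<in> (\<real>\<^sub>\<ge>\<^sub>0 :: quat set) \<longleftrightarrow> 0 \<le> r" for r
    by (auto simp: nonneg_Reals_def)
  then have "qform A v \<in> \<real>\<^sub>\<ge>\<^sub>0 \<longleftrightarrow> 0 \<le> inner v (A *v v)" if "A \<in> herm_mats" for v
    using qform_real[OF that, of v] by (simp add: qform_def flip: qdot_def)
  then show ?thesis
    by (auto simp: psd_herm_mats_def)
qed

lemma herm_mats_add: "A \<in> herm_mats \<Longrightarrow> B \<in> herm_mats \<Longrightarrow> A + B \<in> herm_mats"
  by (simp add: herm_mats_def qadjoint_add)

lemma herm_mats_scaleR: "A \<in> herm_mats \<Longrightarrow> r *\<^sub>R A \<in> herm_mats"
  by (simp add: herm_mats_def qadjoint_scaleR)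

lemma herm_mats_diff: "A \<in> herm_mats \<Longrightarrow> B \<in> herm_mats \<Longrightarrow> A - B \<in> herm_mats"
  using herm_mats_add[OF _ herm_mats_scaleR[of B "-1"], of A] by simp

lemma qouter_psd: "qouter w \<in> psd_herm_mats"
  by (simp add: psd_herm_iff inner_qouter)
    (simp add: herm_mats_def qadjoint_def qouter_def vec_eq_iff qcnj_mult)

text \<open>Near t = 0 the linear term dominates the quadratic one, so a nonzero linear coefficient
  would make the polynomial negative on one side of 0.\<close>

lemma linear_coeff_zero:
  fixes b c :: real
  assumes "\<And>t. 0 \<le> 2 * t * b + t\<^sup>2 * c"
  shows "b = 0"
proof (rule ccontr)
  assume "b \<noteq> 0"
  define s where "s = b / (\<bar>c\<bar> + 1)"
  have s: "b = s * (\<bar>c\<bar> + 1)"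
    by (simp add: s_def add_nonneg_eq_0_iff)
  have "0 \<le> 2 * (- s) * b + (- s)\<^sup>2 * c"
    by (rule assms)
  also have "\<dots> = s\<^sup>2 * (c - 2 * (\<bar>c\<bar> + 1))"
    by (simp add: s power2_eq_square algebra_simps)
  also have "\<dots> < 0"
    using \<open>b \<noteq> 0\<close> s by (intro mult_pos_neg) auto
  finally show False
    by simp
qed

text \<open>A zero of a PSD form is a minimum, so the first variation vanishes there; in the
  direction A v it is a multiple of |A v|^2.\<close>

lemma psd_form_zero_imp_kernel:
  assumes A: "A \<in> psd_herm_mats" and v: "inner v (A *v v) = 0"
  shows "A *v v = 0"
proof -
  have h: "A \<in> herm_mats" and p: "\<And>x. 0 \<le> inner x (A *v x)"
    using A by (auto simp: psd_herm_iff)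
  define u where "u = A *v v"
  have "0 \<le> 2 * t * inner u u + t\<^sup>2 * inner u (A *v u)" for t
    using p[of "v + t *\<^sub>R u"] v inner_herm[OF h, of v u]
    by (simp add: u_def matrix_vector_right_distrib qmatrix_scaleR_right inner_add_left
        inner_add_right inner_commute power2_eq_square algebra_simps)
  then have "inner u u = 0"
    by (rule linear_coeff_zero)
  then show ?thesis
    by (simp add: u_def)
qed

section \<open>Block matrices\<close>

definition sym2 :: "real \<Rightarrow> real \<Rightarrow> real \<Rightarrow> real^2^2"
  where "sym2 x y z = vector [vector [x, y], vector [y, z]]"

definition block_mat :: "quat^'n^'n \<Rightarrow> quat^'n^'n \<Rightarrow> quat^'n^'n \<Rightarrow> quat^(2 \<times> 'n::finite)^(2 \<times> 'n)"
  where "block_mat A B C = kron (sym2 1 0 0) A + kron (sym2 0 1 0) B + kron (sym2 0 0 1) C"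

definition block_vec :: "quat^'n \<Rightarrow> quat^'n \<Rightarrow> quat^(2 \<times> 'n::finite)"
  where "block_vec x y = (\<chi> p. if fst p = 1 then x $ snd p else y $ snd p)"

text \<open>The quadratic form of \<open>block_mat A B C\<close> at the stacked vector (x, y); the
  factor 2 merges the two cross terms, which agree for hermitian \<open>B\<close>.\<close>

definition block_form :: "quat^'n^'n \<Rightarrow> quat^'n^'n \<Rightarrow> quat^'n^'n \<Rightarrow> quat^'n \<Rightarrow> quat^'n \<Rightarrow> real"
  where "block_form A B C x y = inner x (A *v x) + 2 * inner x (B *v y) + inner y (C *v y)"

lemma sym2_nth [simp]:
  "sym2 x y z $ 1 $ 1 = x" "sym2 x y z $ 1 $ 2 = y" "sym2 x y z $ 2 $ 1 = y" "sym2 x y z $ 2 $ 2 = z"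
  by (simp_all add: sym2_def)

lemma sym2_cases:
  assumes "A \<in> sym_mats"
  obtains x y z where "A = sym2 x y z"
proof
  have "A $ 2 $ 1 = A $ 1 $ 2"
    using assms by (auto simp: sym_mats_def transpose_def dest!: arg_cong[where f = "\<lambda>X. X $ 1 $ 2"])
  then show "A = sym2 (A $ 1 $ 1) (A $ 1 $ 2) (A $ 2 $ 2)"
    by (simp add: vec_eq_iff forall_2)
qed

lemma sym2_psd_iff:
  "sym2 x y z \<in> psd_sym_mats \<longleftrightarrow> (\<forall>s t. 0 \<le> x * s\<^sup>2 + 2 * y * s * t + z * t\<^sup>2)"
proof -
  have form: "v \<bullet> (sym2 x y z *v v) = x * (v $ 1)\<^sup>2 + 2 * y * v $ 1 * v $ 2 + z * (v $ 2)\<^sup>2" for v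
    by (simp add: inner_vec_def matrix_vector_mult_def sum_2 power2_eq_square algebra_simps)
  have "(\<forall>v. 0 \<le> v \<bullet> (sym2 x y z *v v)) \<longleftrightarrow> (\<forall>s t. 0 \<le> x * s\<^sup>2 + 2 * y * s * t + z * t\<^sup>2)"
  proof (intro iffI allI)
    fix s t
    assume "\<forall>v. 0 \<le> v \<bullet> (sym2 x y z *v v)"
    from this[rule_format, of "vector [s, t]"] show "0 \<le> x * s\<^sup>2 + 2 * y * s * t + z * t\<^sup>2"
      unfolding form by simp
  qed (simp add: form)
  moreover have "sym2 x y z \<in> sym_mats"
    by (simp add: sym_mats_def vec_eq_iff transpose_def forall_2)
  ultimately show ?thesis
    by (simp add: psd_sym_mats_def)
qed

lemma kron_sym2: "kron (sym2 x y z) B = block_mat (x *\<^sub>R B) (y *\<^sub>R B) (z *\<^sub>R B)"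
proof -
  have "kron (sym2 x y z) B $ (a, i) $ (b, j)
      = block_mat (x *\<^sub>R B) (y *\<^sub>R B) (z *\<^sub>R B) $ (a, i) $ (b, j)" for a b i j
    using exhaust_2[of a] exhaust_2[of b] by (auto simp: kron_def block_mat_def)
  then show ?thesis
    by (simp add: vec_eq_iff)
qed

lemma block_mat_nth:
  "block_mat A B C $ (1, i) $ (1, j) = A $ i $ j" "block_mat A B C $ (1, i) $ (2, j) = B $ i $ j"
  "block_mat A B C $ (2, i) $ (1, j) = B $ i $ j" "block_mat A B C $ (2, i) $ (2, j) = C $ i $ j"
  by (simp_all add: block_mat_def kron_def)

lemma block_mat_add:
  "block_mat A B C + block_mat A' B' C' = block_mat (A + A') (B + B') (C + C')"
  by (simp add: block_mat_def kron_def vec_eq_iff scaleR_add_right)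

lemma block_mat_form:
  assumes "B \<in> herm_mats"
  shows "inner (block_vec x y) (block_mat A B C *v block_vec x y) = block_form A B C x y"
proof -
  have s: "(\<Sum>p\<in>UNIV. f p) = (\<Sum>i\<in>UNIV. f (1, i)) + (\<Sum>i\<in>UNIV. f (2, i))"
    for f :: "2 \<times> 'a::finite \<Rightarrow> 'b::comm_monoid_add"
    using sum.cartesian_product[of "\<lambda>a i. f (a, i)" UNIV UNIV] by (simp add: sum_2)
  have m: "block_mat A B C *v block_vec x y = block_vec (A *v x + B *v y) (B *v x + C *v y)"
    (is "?l = ?r")
  proof -
    have "?l $ (a, i) = ?r $ (a, i)" for a i
      using exhaust_2[of a]
      by (auto simp: matrix_vector_mult_def s block_mat_nth block_vec_def)
    then show ?thesis
      by (simp add: vec_eq_iff)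
  qed
  have "inner (block_vec x y) (block_vec x' y') = inner x x' + inner y y'" for x' y' :: "quat^'a"
    by (simp add: inner_vec_def s block_vec_def)
  moreover have "inner y (B *v x) = inner x (B *v y)"
    by (metis assms inner_commute inner_herm)
  ultimately show ?thesis
    by (simp add: m block_form_def inner_add_right)
qed

lemma P_cone_iff:
  "M \<in> P_cone \<longleftrightarrow> (\<exists>A B C. M = block_mat A B C \<and> A \<in> herm_mats \<and> B \<in> herm_mats \<and> C \<in> herm_mats
    \<and> (\<forall>x y. 0 \<le> block_form A B C x y))" (is "_ \<longleftrightarrow> ?R")
proof
  assume P: "M \<in> P_cone"
  define A B C where "A = block M 1 1" and "B = block M 1 2" and "C = block M 2 2"
  have h: "A \<in> herm_mats" "B \<in> herm_mats" "C \<in> herm_mats" and b: "block M 2 1 = B"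
    and p: "\<And>v. 0 \<le> inner v (M *v v)"
    using P by (auto simp: P_cone_def mem_tensor_space_iff_blocks psd_herm_iff A_def B_def C_def)
  have "M $ (a, i) $ (b, j) = block_mat A B C $ (a, i) $ (b, j)" for a b i j
    using exhaust_2[of a] exhaust_2[of b] arg_cong[OF b, of "\<lambda>X. X $ i $ j"]
    by (auto simp: block_mat_nth A_def B_def C_def block_def)
  then have "M = block_mat A B C"
    by (simp add: vec_eq_iff)
  with h p show ?R
    by (metis block_mat_form)
next
  assume ?R
  then obtain A B C where M: "M = block_mat A B C" and h: "A \<in> herm_mats" "B \<in> herm_mats" "C \<in> herm_mats"
    and p: "\<And>x y. 0 \<le> block_form A B C x y"
    by blast
  have bl: "block M 1 1 = A" "block M 1 2 = B" "block M 2 1 = B" "block M 2 2 = C"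
    by (simp_all add: M block_def block_mat_nth)
  have c: "qcnj (X $ j $ i) = X $ i $ j" if "X \<in> herm_mats" for X :: "quat^'a^'a" and i j
    using that by (auto simp: herm_mats_def qadjoint_def vec_eq_iff)
  have "qadjoint M $ (a, i) $ (b, j) = M $ (a, i) $ (b, j)" for a b i j
    using exhaust_2[of a] exhaust_2[of b] by (auto simp: qadjoint_def M block_mat_nth c h)
  then have "M \<in> herm_mats"
    by (simp add: herm_mats_def vec_eq_iff)
  moreover have "0 \<le> inner v (M *v v)" for v
  proof -
    have "v $ (a, i) = block_vec (\<chi> i. v $ (1, i)) (\<chi> i. v $ (2, i)) $ (a, i)" for a i
      using exhaust_2[of a] by (auto simp: block_vec_def)
    then have "v = block_vec (\<chi> i. v $ (1, i)) (\<chi> i. v $ (2, i))"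
      unfolding vec_eq_iff split_paired_All by blast
    then show ?thesis
      using p block_mat_form[OF h(2)] M by metis
  qed
  ultimately show "M \<in> P_cone"
    using h by (simp add: P_cone_def mem_tensor_space_iff_blocks bl psd_herm_iff)
qed

section \<open>The two inclusions\<close>

lemma P_cone_0: "0 \<in> P_cone"
proof -
  have "0 = block_mat 0 0 0"
    by (simp add: block_mat_def kron_def vec_eq_iff)
  moreover have "0 \<in> herm_mats"
    by (simp add: herm_mats_def qadjoint_0)
  ultimately show ?thesis
    by (force simp: P_cone_iff block_form_def)
qed

lemma P_cone_add:
  assumes "M \<in> P_cone" "N \<in> P_cone"
  shows "M + N \<in> P_cone"
proof -
  obtain A B C A' B' C' where M: "M = block_mat A B C" and N: "N = block_mat A' B' C'"
    and h: "A \<in> herm_mats" "B \<in> herm_mats" "C \<in> herm_mats"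
      "A' \<in> herm_mats" "B' \<in> herm_mats" "C' \<in> herm_mats"
    and p: "\<And>x y. 0 \<le> block_form A B C x y" "\<And>x y. 0 \<le> block_form A' B' C' x y"
    using assms unfolding P_cone_iff by blast
  have "block_form (A + A') (B + B') (C + C') x y = block_form A B C x y + block_form A' B' C' x y"
    for x y
    by (simp add: block_form_def matrix_vector_mult_add_rdistrib inner_add_right)
  then have "0 \<le> block_form (A + A') (B + B') (C + C') x y" for x y
    using p by simp
  then show ?thesis
    unfolding P_cone_iff M N block_mat_add using h by (blast intro: herm_mats_add)
qed

text \<open>If a > 0, a times the form is a square completed in x plus the determinant times the
  \<open>B\<close>-form of y. If a = 0, positivity of the 2 by 2 factor forces b = 0.\<close>

lemma kron_mem_P_cone:
  assumes A: "A \<in> psd_sym_mats" and B: "B \<in> psd_herm_mats"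
  shows "kron A B \<in> P_cone"
proof -
  have "A \<in> sym_mats"
    using A by (simp add: psd_sym_mats_def)
  then obtain a b c where abc: "A = sym2 a b c"
    by (rule sym2_cases)
  have q: "0 \<le> a * s\<^sup>2 + 2 * b * s * t + c * t\<^sup>2" for s t
    using A by (simp add: abc sym2_psd_iff)
  have h: "B \<in> herm_mats" and p: "\<And>x. 0 \<le> inner x (B *v x)"
    using B by (auto simp: psd_herm_iff)
  have a: "0 \<le> a" and c: "0 \<le> c"
    using q[of 1 0] q[of 0 1] by auto
  have F: "block_form (a *\<^sub>R B) (b *\<^sub>R B) (c *\<^sub>R B) x y
      = a * inner x (B *v x) + 2 * b * inner x (B *v y) + c * inner y (B *v y)" (is "?F x y = _") for x y
    by (simp add: block_form_def qmatrix_scaleR_left)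
  have "0 \<le> ?F x y" for x y
  proof (cases "a = 0")
    case True
    have "b = 0"
      using q[of 1] by (intro linear_coeff_zero[of b c]) (simp add: True algebra_simps)
    with True show ?thesis
      unfolding F using c p[of y] by simp
  next
    case False
    then have "0 < a"
      using a by simp
    \<comment> \<open>The test vector (-b, a) evaluates the 2 by 2 form to a times its
      determinant.\<close>
    have "0 \<le> a * (a * c - b\<^sup>2)"
      using q[of "- b" a] by (simp add: power2_eq_square algebra_simps)
    then have d: "0 \<le> a * c - b\<^sup>2"
      using \<open>0 < a\<close> by (simp add: zero_le_mult_iff)
    have "inner y (B *v x) = inner x (B *v y)"
      by (metis h inner_commute inner_herm)
    then have "a * ?F x y = inner (a *\<^sub>R x + b *\<^sub>R y) (B *v (a *\<^sub>R x + b *\<^sub>R y))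
        + (a * c - b\<^sup>2) * inner y (B *v y)"
      unfolding F by (simp add: matrix_vector_right_distrib qmatrix_scaleR_right inner_add_left
          inner_add_right power2_eq_square algebra_simps)
    also have "0 \<le> \<dots>"
      using d p by (intro add_nonneg_nonneg mult_nonneg_nonneg)
    finally show ?thesis
      using \<open>0 < a\<close> by (simp add: zero_le_mult_iff)
  qed
  then show ?thesis
    unfolding P_cone_iff abc kron_sym2 using h by (blast intro: herm_mats_scaleR)
qed

lemma Sigma_cone_subset_P_cone: "Sigma_cone \<subseteq> P_cone"
proof
  fix M :: "quat^(2 \<times> 'a::finite)^(2 \<times> 'a)"
  assume "M \<in> Sigma_cone"
  then obtain k :: nat and A B where AB: "\<forall>l<k. A l \<in> psd_sym_mats \<and> B l \<in> psd_herm_mats"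
    and M: "M = (\<Sum>l<k. kron (A l) (B l))"
    by (auto simp: Sigma_cone_def separable_def)
  have "(\<Sum>l<m. kron (A l) (B l)) \<in> P_cone" if "m \<le> k" for m
    using that AB by (induction m) (auto simp: Suc_le_eq intro: P_cone_0 P_cone_add kron_mem_P_cone)
  then show "M \<in> P_cone"
    by (simp add: M)
qed

section \<open>Positive semidefinite matrices are separable\<close>

lemma Sigma_cone_add_kron:
  assumes "M \<in> Sigma_cone" "A \<in> psd_sym_mats" "B \<in> psd_herm_mats"
  shows "M + kron A B \<in> Sigma_cone"
proof -
  obtain k :: nat and A' B' where AB: "\<forall>l<k. A' l \<in> psd_sym_mats \<and> B' l \<in> psd_herm_mats"
    and M: "M = (\<Sum>l<k. kron (A' l) (B' l))"
    using assms(1) by (auto simp: Sigma_cone_def separable_def)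
  have "M + kron A B = (\<Sum>l<Suc k. kron ((A'(k := A)) l) ((B'(k := B)) l))"
    by (simp add: M)
  moreover have "\<forall>l<Suc k. (A'(k := A)) l \<in> psd_sym_mats \<and> (B'(k := B)) l \<in> psd_herm_mats"
    using AB assms by (auto simp: less_Suc_eq)
  ultimately show ?thesis
    unfolding Sigma_cone_def separable_def by blast
qed

lemma Sigma_cone_0: "0 \<in> Sigma_cone"
  unfolding Sigma_cone_def separable_def by (auto intro!: exI[of _ "0::nat"])

text \<open>The minimum of the Rayleigh quotient of the pencil \<open>(A, B)\<close> is attained,
  since both forms descend to the quotient by the kernel of \<open>A\<close>.\<close>

lemma generalized_eigenvector:
  assumes A: "A \<in> psd_herm_mats" and B: "B \<in> herm_mats" and "A \<noteq> 0"
    and ker: "\<And>x. A *v x = 0 \<Longrightarrow> B *v x = 0"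
  obtains v \<mu> where "inner v (A *v v) = 1" "B *v v = \<mu> *\<^sub>R (A *v v)"
proof -
  have hA: "A \<in> herm_mats" and pA: "\<And>x. 0 \<le> inner x (A *v x)"
    using A by (auto simp: psd_herm_iff)
  define K where "K = {x. A *v x = 0}"
  \<comment> \<open>The orthogonal complement of \<open>K\<close> represents the quotient by the
    kernel. Its unit sphere is compact, and the \<open>A\<close>-form is strictly positive on
    it.\<close>
  define S where "S = {x. norm x = 1 \<and> (\<forall>y\<in>K. orthogonal y x)}"
  have K: "subspace K"
    unfolding K_def using linear_qmatrix[of A] by (rule linear_subspace_kernel)
  have decomp: "\<exists>k z. k \<in> K \<and> (\<forall>y\<in>K. orthogonal y z) \<and> x = k + z" for x
    using orthogonal_subspace_decomp_exists[of K x] span_eq_iff[of K] K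
    by (metis orthogonal_commute)
  have form: "inner (k + z) (X *v (k + z)) = inner z (X *v z)"
    if "X *v k = 0" "X \<in> herm_mats" for k z and X :: "quat^'a^'a"
    using that inner_herm[of X k z] by (simp add: matrix_vector_right_distrib inner_add_left)
  have pos: "0 < inner x (A *v x)" if "x \<in> S" for x
  proof (rule ccontr)
    assume "\<not> ?thesis"
    then have "inner x (A *v x) = 0"
      using pA[of x] by simp
    then have "x \<in> K"
      using psd_form_zero_imp_kernel[OF A] by (simp add: K_def)
    then have "orthogonal x x" "norm x = 1"
      using that by (auto simp: S_def)
    then show False
      by (auto simp: orthogonal_def)
  qed
  have normalize: "z /\<^sub>R norm z \<in> S" if "\<forall>y\<in>K. orthogonal y z" "z \<noteq> 0" for z
    using that by (auto simp: S_def orthogonal_clauses)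
  have "S \<noteq> {}"
  proof
    assume "S = {}"
    have "A *v x = 0" for x
    proof -
      obtain k z where k: "k \<in> K" and z: "\<forall>y\<in>K. orthogonal y z" and x: "x = k + z"
        using decomp by blast
      have "z = 0"
        using normalize[OF z] \<open>S = {}\<close> by blast
      then show ?thesis
        using k by (simp add: x K_def)
    qed
    \<comment> \<open>These products are the columns of \<open>A\<close>.\<close>
    then have "A *v axis j 1 = 0" for j
      by blast
    then have "A $ i $ j = 0" for i j
      by (simp add: matrix_vector_mult_def axis_def vec_eq_iff if_distrib cong: if_cong)
    with \<open>A \<noteq> 0\<close> show False
      by (simp add: vec_eq_iff)
  qed
  moreover have "compact S"
  proof -
    have "S = sphere 0 1 \<inter> {x. \<forall>y\<in>K. y \<bullet> x = 0}"
      by (auto simp: S_def orthogonal_def)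
    moreover have "{x. \<forall>y\<in>K. y \<bullet> x = 0} = (\<Inter>y\<in>K. {x. y \<bullet> x = 0})"
      by auto
    moreover have "closed (\<Inter>y\<in>K. {x. y \<bullet> x = 0})"
      by (intro closed_INT ballI closed_Collect_eq continuous_intros)
    ultimately show ?thesis
      by (simp add: compact_Int_closed)
  qed
  moreover have "continuous_on S (\<lambda>x. inner x (B *v x) / inner x (A *v x))"
  proof -
    have "continuous_on S ((*v) X)" for X :: "quat^'a^'a"
      by (simp add: linear_continuous_on linear_linear linear_qmatrix)
    moreover have "\<forall>x\<in>S. inner x (A *v x) \<noteq> 0"
      using pos by force
    ultimately show ?thesis
      by (intro continuous_on_divide continuous_on_inner continuous_on_id)
  qed
  ultimately have "\<exists>s\<in>S. \<forall>x\<in>S. inner s (B *v s) / inner s (A *v s)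
      \<le> inner x (B *v x) / inner x (A *v x)"
    by (intro continuous_attains_inf)
  then obtain s where s: "s \<in> S" and
    min: "\<And>x. x \<in> S \<Longrightarrow> inner s (B *v s) / inner s (A *v s) \<le> inner x (B *v x) / inner x (A *v x)"
    by blast
  define \<mu> where "\<mu> = inner s (B *v s) / inner s (A *v s)"
  \<comment> \<open>As \<mu> is the minimal quotient, \<open>D\<close> is PSD; its form vanishes at
    the minimizer \<open>s\<close>, so \<open>s\<close> lies in the kernel of \<open>D\<close>,
    which is the eigenvector equation.\<close>
  define D where "D = B - \<mu> *\<^sub>R A"
  have Dv: "D *v x = B *v x - \<mu> *\<^sub>R (A *v x)" for x
    by (simp add: D_def matrix_vector_mult_diff_rdistrib qmatrix_scaleR_left)
  have hD: "D \<in> herm_mats"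
    unfolding D_def using hA B by (intro herm_mats_diff herm_mats_scaleR)
  \<comment> \<open>The component in \<open>K\<close> contributes nothing, and the other component
    rescales to a point of \<open>S\<close>.\<close>
  have "0 \<le> inner x (D *v x)" for x
  proof -
    obtain k z where k: "k \<in> K" and z: "\<forall>y\<in>K. orthogonal y z" and x: "x = k + z"
      using decomp by blast
    have "D *v k = 0"
      using k ker by (simp add: Dv K_def)
    then have "inner x (D *v x) = inner z (D *v z)"
      unfolding x using hD by (rule form)
    moreover have "0 \<le> inner z (D *v z)"
    proof (cases "z = 0")
      case False
      define u where "u = z /\<^sub>R norm z"
      have u: "u \<in> S"
        unfolding u_def using z False by (rule normalize)
      have "\<mu> * inner u (A *v u) \<le> inner u (B *v u)"
        using min[OF u] pos[OF u] by (simp add: \<mu>_def pos_le_divide_eq)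
      then have "0 \<le> inner u (D *v u)"
        by (simp add: Dv inner_diff_right)
      moreover have "z = norm z *\<^sub>R u"
        using False by (simp add: u_def)
      then have "inner z (D *v z) = norm z * (norm z * inner u (D *v u))"
        by (metis inner_scaleR_left inner_scaleR_right qmatrix_scaleR_right)
      ultimately show ?thesis
        by simp
    qed simp
    ultimately show ?thesis
      by simp
  qed
  then have "D \<in> psd_herm_mats"
    using hD by (simp add: psd_herm_iff)
  moreover have "inner s (D *v s) = 0"
    using pos[OF s] by (simp add: Dv inner_diff_right \<mu>_def)
  ultimately have "D *v s = 0"
    by (rule psd_form_zero_imp_kernel)
  then have eig: "B *v s = \<mu> *\<^sub>R (A *v s)"
    by (simp add: Dv)
  define v where "v = s /\<^sub>R sqrt (inner s (A *v s))"
  show thesis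
  proof
    show "inner v (A *v v) = 1"
      using pos[OF s] by (simp add: v_def qmatrix_scaleR_right field_simps)
    show "B *v v = \<mu> *\<^sub>R (A *v v)"
      by (simp add: v_def qmatrix_scaleR_right eig)
  qed
qed

text \<open>The induction runs over the rank of \<open>A\<close>: with \<open>w = A v\<close> for a normalized generalized
  eigenvector \<open>v\<close>, subtracting \<open>(1, \<mu>) (1, \<mu>)\<^sup>T \<otimes> w w\<^sup>*\<close> puts \<open>v\<close> into the kernel of \<open>A\<close>.\<close>

lemma block_mat_mem_Sigma_cone:
  fixes A B C :: "quat^'n::finite^'n"
  assumes "A \<in> herm_mats" "B \<in> herm_mats" "C \<in> herm_mats"
    and "\<And>x y. 0 \<le> block_form A B C x y"
  shows "block_mat A B C \<in> Sigma_cone"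
  using assms
\<comment> \<open>The measure is the real codimension of the kernel, four times the quaternionic
  rank of \<open>A\<close>.\<close>
proof (induction "DIM(quat^'n) - dim {x. A *v x = 0}" arbitrary: A B C rule: less_induct)
  case less
  note h = less.prems(1-3) and F = less.prems(4)
  have A: "A \<in> psd_herm_mats"
    using h F[of _ 0] by (simp add: psd_herm_iff block_form_def)
  have C: "C \<in> psd_herm_mats"
    using h F[of 0] by (simp add: psd_herm_iff block_form_def)
  \<comment> \<open>At (x, t u) with A x = 0 and u = B x the form is 2 t |u|^2 + t^2 u^* C u, whose
    linear coefficient must vanish.\<close>
  have ker: "B *v x = 0" if "A *v x = 0" for x
  proof -
    define u where "u = B *v x"
    have "0 \<le> 2 * t * inner u u + t\<^sup>2 * inner u (C *v u)" for t
      using F[of x "t *\<^sub>R u"] that inner_herm[OF h(2), of x u]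
      by (simp add: block_form_def u_def qmatrix_scaleR_right power2_eq_square algebra_simps)
    then have "inner u u = 0"
      by (rule linear_coeff_zero)
    then show ?thesis
      by (simp add: u_def)
  qed
  show ?case
  proof (cases "A = 0")
    \<comment> \<open>The kernel inclusion now gives B = 0, leaving a single Kronecker term with
      factor \<open>C\<close>.\<close>
    case True
    then have "B *v axis j 1 = 0" for j
      using ker by simp
    then have "B = 0"
      by (simp add: matrix_vector_mult_def axis_def vec_eq_iff if_distrib cong: if_cong)
    have "sym2 0 0 1 \<in> psd_sym_mats"
      by (simp add: sym2_psd_iff)
    then have "0 + kron (sym2 0 0 1) C \<in> Sigma_cone"
      using Sigma_cone_0 C by (intro Sigma_cone_add_kron)
    then show ?thesis
      by (simp add: kron_sym2 True \<open>B = 0\<close>)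
  next
    case False
    obtain v \<mu> where v: "inner v (A *v v) = 1" and eig: "B *v v = \<mu> *\<^sub>R (A *v v)"
      using generalized_eigenvector[OF A h(2) False ker] .
    define w where "w = A *v v"
    define W where "W = qouter w"
    have W: "W \<in> psd_herm_mats" "W \<in> herm_mats"
      using qouter_psd[of w] by (simp_all add: W_def psd_herm_iff)
    define A' B' C' where "A' = A - W" and "B' = B - \<mu> *\<^sub>R W" and "C' = C - \<mu>\<^sup>2 *\<^sub>R W"
    have h': "A' \<in> herm_mats" "B' \<in> herm_mats" "C' \<in> herm_mats"
      using h W by (simp_all add: A'_def B'_def C'_def herm_mats_diff herm_mats_scaleR)
    \<comment> \<open>The normalization fixes only the real part, but v^* A v is real, so it equals
      1 as a quaternion.\<close>
    have dv: "qdot v w = 1" "qdot w v = 1"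
      using qform_real[OF h(1), of v] v qdot_herm[OF h(1), of v v] by (simp_all add: w_def)
    have dA: "qdot v (A *v x) = qdot w x" for x
      using qdot_herm[OF h(1)] by (simp add: w_def)
    have dB: "qdot v (B *v x) = \<mu> *\<^sub>R qdot w x" for x
      by (simp add: qdot_herm[OF h(2)] eig w_def qdot_scaleR_left)
    have "0 \<le> block_form A' B' C' x y" for x y
    proof -
      \<comment> \<open>Minimizing the form over \<open>x - v q\<close> for quaternions \<open>q\<close> removes exactly the subtracted term.\<close>
      define q where "q = qdot w x + \<mu> *\<^sub>R qdot w y"
      define u where "u = rscale v q"
      have "inner u (A *v x) = inner q (qdot w x)" "inner u (B *v y) = \<mu> * inner q (qdot w y)"
        by (simp_all add: u_def inner_rscale_left dA dB)
      then have ux: "inner u (A *v x) + inner u (B *v y) = inner q q"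
        by (simp add: q_def inner_add_right)
      have "inner u (A *v u) = inner q q"
        by (simp add: u_def inner_rscale_left dA qdot_rscale_right dv)
      moreover have "inner x (A *v u) = inner u (A *v x)"
        by (metis h(1) inner_commute inner_herm)
      \<comment> \<open>The cross terms contribute -2 |q|^2 and the term u^* A u contributes
        |q|^2.\<close>
      ultimately have "block_form A B C (x - u) y = block_form A B C x y - inner q q"
        using ux by (simp add: block_form_def matrix_vector_mult_diff_distrib inner_diff_left
            inner_diff_right)
      \<comment> \<open>The form of the subtracted Kronecker term is |w^* x + \<mu> w^* y|^2, that
        is |q|^2.\<close>
      moreover have "block_form A' B' C' x y = block_form A B C x y - inner q q"
        by (simp add: block_form_def A'_def B'_def C'_def W_def q_def matrix_vector_mult_diff_rdistrib
            qmatrix_scaleR_left inner_diff_right inner_qouter inner_add_left inner_add_right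
            inner_commute power2_eq_square algebra_simps)
      ultimately show ?thesis
        using F[of "x - u" y] by simp
    qed
    note F' = this
    \<comment> \<open>If A x = 0 then w^* x = v^* A x = 0, so the old kernel survives;
      \<open>v\<close> is new, since A' v = w - w (w^* v) = 0.\<close>
    have "dim {x. A *v x = 0} < dim {x. A' *v x = 0}"
    proof (rule dim_psubset)
      have "A' *v x = 0" if "A *v x = 0" for x
        using that dA[of x] by (simp add: A'_def W_def matrix_vector_mult_diff_rdistrib qouter_mult
            qdot_def rscale_def vec_eq_iff)
      moreover have "A' *v v = 0"
        by (simp add: A'_def W_def matrix_vector_mult_diff_rdistrib qouter_mult dv)
          (simp add: rscale_def w_def vec_eq_iff)
      moreover have "A *v v \<noteq> 0"
        using v by auto
      ultimately have "{x. A *v x = 0} \<subset> {x. A' *v x = 0}"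
        by blast
      moreover have "span {x. X *v x = 0} = {x. X *v x = 0}" for X :: "quat^'n^'n"
        unfolding span_eq_iff using linear_qmatrix[of X] by (rule linear_subspace_kernel)
      ultimately show "span {x. A *v x = 0} \<subset> span {x. A' *v x = 0}"
        by (simp only:)
    qed
    \<comment> \<open>The measure uses truncated subtraction; this bound makes its decrease
      strict.\<close>
    moreover have "dim {x. A' *v x = 0} \<le> DIM(quat^'n)"
      by (rule dim_subset_UNIV)
    ultimately have "block_mat A' B' C' \<in> Sigma_cone"
      using h' F' by (intro less.hyps) linarith+
    moreover have "sym2 1 \<mu> (\<mu>\<^sup>2) \<in> psd_sym_mats"
    proof -
      have "1 * s\<^sup>2 + 2 * \<mu> * s * t + \<mu>\<^sup>2 * t\<^sup>2 = (s + \<mu> * t)\<^sup>2" for s t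
        by (simp add: power2_eq_square algebra_simps)
      then show ?thesis
        unfolding sym2_psd_iff by simp
    qed
    ultimately have "block_mat A' B' C' + kron (sym2 1 \<mu> (\<mu>\<^sup>2)) W \<in> Sigma_cone"
      using W(1) by (rule Sigma_cone_add_kron)
    then show ?thesis
      by (simp add: kron_sym2 block_mat_add A'_def B'_def C'_def)
  qed
qed

theorem theorem7p6:
  shows "(P_cone :: (quat^(2 \<times> 'n::finite)^(2 \<times> 'n)) set) = Sigma_cone"
proof
  show "(P_cone :: (quat^(2 \<times> 'n)^(2 \<times> 'n)) set) \<subseteq> Sigma_cone"
    using block_mat_mem_Sigma_cone unfolding subset_iff P_cone_iff by blast
qed (rule Sigma_cone_subset_P_cone)

end
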